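(* Let $U$ be the set of natural numbers $n$ whose $\varphi$-representation contains exactly one odd exponent. Then the set of Zeckendorf representations of elements of $U$ is accepted by a deterministic finite automaton (i.e. is a regular language). Furthermore, a natural number $n$ lies in $U$ if and only if $n-2$ is a (possibly empty) sum of distinct even-indexed Lucas numbers $L_{2i}$ with $i \ge 2$. Finally, for every $n \in U$, the unique odd exponent in its $\varphi$-representation equals $1$.
   Context: $\varphi = (1+\sqrt{5})/2$. Every real $x \ge 0$ has a unique $\varphi$-representation $x = \sum_{i \le t} e_i \varphi^i$ with $e_i \in \{0,1\}$, $e_i e_{i+1} = 0$ for all $i$, and no infinite tail $1010\cdots$; for natural numbers it is finite. The exponents of the representation are the $i$ with $e_i = 1$. Lucas numbers: $L_0 = 2$, $L_1 = 1$, $L_k = L_{k-1} + L_{k-2}$. The Zeckendorf representation of $n$ is the unique binary string $b_t \cdots b_2$ (no leading zero, no two adjacent $1$s) with $n = \sum_{i=2}^t b_i F_i$, where $F_i$ are the Fibonacci numbers ($F_0=0,F_1=1$). *)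

theory Defs
  imports "HOL-Analysis.Analysis" "HOL-Number_Theory.Fib"
begin

definition golden_ratio :: real where
  "golden_ratio = (1 + sqrt 5) / 2"

text \<open>Digits are indexed by all integers; those above the leading position are zero. The last
  conjunct excludes expansions ending in the infinite block 101010... .\<close>

definition is_phi_rep :: "real \<Rightarrow> (int \<Rightarrow> nat) \<Rightarrow> bool" where
  "is_phi_rep x e \<longleftrightarrow>
     (\<forall>i. e i \<in> {0, 1}) \<and>
     (\<forall>i. e i * e (i + 1) = 0) \<and>
     (\<exists>t. (\<forall>i>t. e i = 0) \<and> ((\<lambda>i. real (e i) * golden_ratio powi i) has_sum x) {..t}) \<and>
     \<not> (\<exists>k. \<forall>j::nat. e (k - 2 * int j) = 1 \<and> e (k - 2 * int j - 1) = 0)"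

definition phi_rep :: "real \<Rightarrow> int \<Rightarrow> nat" where
  "phi_rep x = (THE e. is_phi_rep x e)"

definition phi_exponents :: "real \<Rightarrow> int set" where
  "phi_exponents x = {i. phi_rep x i = 1}"

fun lucas :: "nat \<Rightarrow> nat" where
  "lucas 0 = 2"
| "lucas (Suc 0) = 1"
| "lucas (Suc (Suc k)) = lucas (Suc k) + lucas k"

text \<open>Binary strings are written most significant digit first, with True for the digit 1. The
  string of digits b_t ... b_2 has length t - 1, so position j carries the weight F_(t - j).
  Zero is represented by the empty string.\<close>

definition is_zeckendorf :: "nat \<Rightarrow> bool list \<Rightarrow> bool" where
  "is_zeckendorf n w \<longleftrightarrow>
     (w \<noteq> [] \<longrightarrow> hd w) \<and>
     (\<forall>j. Suc j < length w \<longrightarrow> \<not> (w ! j \<and> w ! Suc j)) \<and>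
     n = (\<Sum>j<length w. of_bool (w ! j) * fib (length w + 1 - j))"

definition zeckendorf :: "nat \<Rightarrow> bool list" where
  "zeckendorf n = (THE w. is_zeckendorf n w)"

record ('q, 'a) dfa =
  states :: "'q set"
  init :: 'q
  trans_fun :: "'q \<Rightarrow> 'a \<Rightarrow> 'q"
  accepting :: "'q set"

definition is_dfa :: "('q, 'a :: finite) dfa \<Rightarrow> bool" where
  "is_dfa M \<longleftrightarrow> finite (states M) \<and> init M \<in> states M \<and> accepting M \<subseteq> states M \<and>
     (\<forall>q \<in> states M. \<forall>a. trans_fun M q a \<in> states M)"

definition dfa_language :: "('q, 'a :: finite) dfa \<Rightarrow> 'a list set" where
  "dfa_language M = {w. foldl (trans_fun M) (init M) w \<in> accepting M}"

text \<open>States are natural numbers without loss of generality, the state set being finite.\<close>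

definition regular_language :: "'a :: finite list set \<Rightarrow> bool" where
  "regular_language A \<longleftrightarrow> (\<exists>M :: (nat, 'a) dfa. is_dfa M \<and> dfa_language M = A)"

definition one_odd_exponent :: "nat set" where
  "one_odd_exponent = {n. card {i \<in> phi_exponents (real n). odd i} = 1}"

end

theory Submission
  imports Defs
begin

text \<open>Write \<open>\<psi>\<close> for the conjugate of \<open>\<phi>\<close>. Adding a power of the base to a finite expansion and
  normalising uses only \<open>x\<^sup>2 = x + 1\<close>, so the exponent set \<open>T\<close> of \<open>n\<close> satisfies
  \<open>\<Sum>i\<in>T. \<phi>\<^sup>i = n = \<Sum>i\<in>T. \<psi>\<^sup>i\<close>. If \<open>d\<close> is the only odd element of \<open>T\<close> and \<open>E\<close> is the set of
  the even ones, then comparing the two sums shows that \<open>-E\<close> is the expansion of the value of \<open>E\<close>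
  increased by \<open>\<phi>\<close> to the powers \<open>d\<close> and \<open>-d\<close>. Normalising that sum leaves an odd exponent unless
  \<open>d = 1\<close>, \<open>-2 \<in> E\<close> and \<open>-E\<close> is \<open>E\<close> with \<open>-2\<close> replaced by \<open>2\<close>. So \<open>T\<close> consists of \<open>1\<close>, \<open>-2\<close> and
  pairs \<open>\<plusminus>2i\<close> with \<open>i \<ge> 2\<close>, and each such pair contributes a Lucas number.

  For regularity, a Zeckendorf word is compared from the left with a guessed sum of Lucas numbers. The
  difference after a prefix is \<open>p F\<close> plus \<open>q F'\<close> for consecutive Fibonacci numbers; \<open>p \<psi> + q\<close> is
  bounded because \<open>\<psi>\<close> contracts, and a second linear form is bounded whenever the remaining digits
  can still cancel the difference. Hence only finitely many pairs \<open>(p, q)\<close> matter, and the language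
  has finitely many residuals.\<close>

section \<open>Expansions in base phi\<close>

abbreviation phi :: real where "phi \<equiv> golden_ratio"

abbreviation psi :: real where "psi \<equiv> - 1 / phi"

lemma phi_gt_1: "phi > 1"
  unfolding golden_ratio_def by (simp add: real_less_rsqrt)

lemma phi_square: "phi\<^sup>2 = phi + 1"
  unfolding golden_ratio_def by (simp add: power2_eq_square field_simps)

lemma conjugate_square: "psi\<^sup>2 = psi + 1"
  using phi_square phi_gt_1 by (simp add: field_simps power2_eq_square)

lemma golden_root_nonzero:
  fixes x :: real
  assumes "x\<^sup>2 = x + 1"
  shows "x \<noteq> 0"
  using assms by auto

text \<open>Proved for an arbitrary root, so that identities between powers are available at both
  \<open>phi\<close> and \<open>psi\<close>.\<close>

lemma powi_golden_root:
  fixes x :: real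
  assumes "x\<^sup>2 = x + 1"
  shows "x powi k + x powi (k + 1) = x powi (k + 2)"
proof -
  have "x powi (k + 2) = x powi k * x\<^sup>2" "x powi (k + 1) = x powi k * x"
    using golden_root_nonzero[OF assms] by (simp_all add: power_int_add)
  then show ?thesis using assms by (simp add: algebra_simps)
qed

lemma powi_golden_root_double:
  fixes x :: real
  assumes "x\<^sup>2 = x + 1"
  shows "2 * x powi k = x powi (k + 1) + x powi (k - 2)"
  using powi_golden_root[OF assms, of "k - 1"] powi_golden_root[OF assms, of "k - 2"]
  by (simp add: add.commute)

lemmas phi_powi = powi_golden_root[OF phi_square]

lemma phi_powi_Suc: "phi powi (k + 1) = phi powi k + phi powi (k - 1)"
  using phi_powi[of "k - 1"] by (simp add: add.commute)

lemma phi_powi_pos [simp]: "phi powi k > 0"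
  using phi_gt_1 by simp

lemma phi_powi_mono: "i \<le> j \<Longrightarrow> phi powi i \<le> phi powi j"
  using phi_gt_1 by (intro power_int_increasing) auto

section \<open>Finite sums of powers with non-adjacent exponents\<close>

definition nonadj :: "int set \<Rightarrow> bool" where
  "nonadj T \<longleftrightarrow> (\<forall>i\<in>T. i + 1 \<notin> T)"

lemma nonadjD: "nonadj T \<Longrightarrow> i \<in> T \<Longrightarrow> i + 1 \<notin> T"
  by (simp add: nonadj_def)

lemma nonadjD': "nonadj T \<Longrightarrow> i \<in> T \<Longrightarrow> i - 1 \<notin> T"
  unfolding nonadj_def by force

lemma nonadj_subset: "nonadj T \<Longrightarrow> S \<subseteq> T \<Longrightarrow> nonadj S"
  unfolding nonadj_def by blast

lemma nonadj_insert:
  "nonadj (insert k S) \<longleftrightarrow> nonadj S \<and> k - 1 \<notin> S \<and> k + 1 \<notin> S"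
  unfolding nonadj_def by force

text \<open>The only case in which no digit is lost, \<open>2 x\<^sup>k = x\<^sup>k\<^sup>+\<^sup>1 + x\<^sup>k\<^sup>-\<^sup>2\<close> with \<open>k + 2 \<notin> S\<close>, moves the carry
  below \<open>k\<close>; hence the inner induction on the number of digits up to \<open>k\<close>.\<close>

lemma nonadj_add_power:
  assumes "finite S" "nonadj S"
  shows "\<exists>T. finite T \<and> nonadj T \<and> card T \<le> Suc (card S) \<and>
    (\<forall>x::real. x\<^sup>2 = x + 1 \<longrightarrow> (\<Sum>i\<in>T. x powi i) = (\<Sum>i\<in>S. x powi i) + x powi k)"
    (is "\<exists>T. ?P S k T")
  using assms
proof (induction "card S" arbitrary: S k rule: less_induct)
  case less
  note outer = less.hyps
  show ?case using less.prems outer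
  proof (induction "card {s\<in>S. s \<le> k}" arbitrary: S k rule: less_induct)
    case (less S k)
    note fin = less.prems(1) and sp = less.prems(2) and outer = less.prems(3)
    have outer': "\<exists>T. ?P S' k' T" if "S' \<subset> S" for S' k'
      using that fin sp by (intro outer) (auto simp: psubset_card_mono intro: finite_subset nonadj_subset)
    consider "k + 1 \<in> S" | "k - 1 \<in> S" | "k \<in> S" "k + 2 \<in> S" | "k \<in> S" "k + 2 \<notin> S"
      | "k \<notin> S" "k - 1 \<notin> S" "k + 1 \<notin> S" by blast
    then show ?case
    proof cases
      case 1
      obtain T where T: "?P (S - {k + 1}) (k + 2) T"
        using outer'[of "S - {k + 1}"] 1 by blast
      have "(\<Sum>i\<in>T. x powi i) = (\<Sum>i\<in>S. x powi i) + x powi k" if x: "x\<^sup>2 = x + 1" for x :: real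
        using T x powi_golden_root[OF x, of k] sum.remove[OF fin 1, of "\<lambda>i. x powi i"] by auto
      then have "?P S k T" using T card_Diff1_le[of S "k + 1"] by auto
      then show ?thesis by blast
    next
      case 2
      obtain T where T: "?P (S - {k - 1}) (k + 1) T"
        using outer'[of "S - {k - 1}"] 2 by blast
      have "(\<Sum>i\<in>T. x powi i) = (\<Sum>i\<in>S. x powi i) + x powi k" if x: "x\<^sup>2 = x + 1" for x :: real
        using T x powi_golden_root[OF x, of "k - 1"] sum.remove[OF fin 2, of "\<lambda>i. x powi i"]
        by (auto simp: add.commute)
      then have "?P S k T" using T card_Diff1_le[of S "k - 1"] by auto
      then show ?thesis by blast
    next
      case 3
      let ?R = "S - {k} - {k + 2}"
      have k2: "k + 2 \<in> S - {k}" using 3 by simp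
      obtain T1 where T1: "?P ?R (k + 3) T1"
        using outer'[of ?R] 3 by blast
      \<comment> \<open>Two digits were removed and at most one is gained by the first carry, so the
        second carry again falls under the outer induction. This is the use of the cardinality bound
        in the statement.\<close>
      have cR: "Suc (card ?R) < card S"
        using 3 k2 fin by (metis card_Suc_Diff1 finite_Diff lessI)
      then obtain T where T: "?P T1 (k - 2) T"
        using outer[of T1 "k - 2"] T1 by fastforce
      have "(\<Sum>i\<in>T. x powi i) = (\<Sum>i\<in>S. x powi i) + x powi k" if x: "x\<^sup>2 = x + 1" for x :: real
      proof -
        have "(\<Sum>i\<in>S. x powi i) = x powi k + (x powi (k + 2) + (\<Sum>i\<in>?R. x powi i))"
          using sum.remove[OF fin 3(1), of "\<lambda>i. x powi i"]
            sum.remove[OF _ k2, of "\<lambda>i. x powi i"] fin by simp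
        then show ?thesis
          using T T1 x powi_golden_root[OF x, of "k + 1"] powi_golden_root_double[OF x, of k]
          by (auto simp: algebra_simps)
      qed
      then have "?P S k T" using T T1 cR by auto
      then show ?thesis by blast
    next
      case 4
      let ?R = "insert (k + 1) (S - {k})"
      have k1: "k + 1 \<notin> S" using sp 4(1) by (rule nonadjD)
      have cR: "card ?R = card S"
        using card_Suc_Diff1[OF fin 4(1)] fin k1 by simp
      have "{s \<in> ?R. s \<le> k - 2} \<subseteq> {s \<in> S. s \<le> k}" "k \<in> {s \<in> S. s \<le> k}"
        "k \<notin> {s \<in> ?R. s \<le> k - 2}"
        using 4(1) by simp_all (force)
      then have "{s \<in> ?R. s \<le> k - 2} \<subset> {s \<in> S. s \<le> k}" by blast
      then have "card {s \<in> ?R. s \<le> k - 2} < card {s \<in> S. s \<le> k}"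
        using fin by (intro psubset_card_mono) auto
      moreover have "nonadj ?R"
        using sp 4 by (auto simp: nonadj_insert add.commute intro: nonadj_subset)
      ultimately obtain T where T: "?P ?R (k - 2) T"
        using less.hyps[of ?R "k - 2"] fin outer unfolding cR by blast
      have "(\<Sum>i\<in>T. x powi i) = (\<Sum>i\<in>S. x powi i) + x powi k" if x: "x\<^sup>2 = x + 1" for x :: real
        using T x fin k1 powi_golden_root_double[OF x, of k]
          sum.remove[OF fin 4(1), of "\<lambda>i. x powi i"]
        by auto
      then have "?P S k T" using T cR by auto
      then show ?thesis by blast
    next
      case 5
      then have "?P S k (insert k S)"
        using fin sp by (auto simp: nonadj_insert)
      then show ?thesis by blast
    qed
  qed
qed

text \<open>Start from the empty set and add \<open>x powi 0\<close> n times. Keeping all roots in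
  the claim retains the equation at \<open>psi\<close>, on which the reflection argument
  rests.\<close>

lemma nat_nonadj_power_sum:
  "\<exists>T. finite T \<and> nonadj T \<and> (\<forall>x::real. x\<^sup>2 = x + 1 \<longrightarrow> (\<Sum>i\<in>T. x powi i) = real n)"
proof (induction n)
  case 0
  show ?case by (intro exI[of _ "{}"]) (auto simp: nonadj_def)
next
  case (Suc n)
  then obtain S where S: "finite S" "nonadj S"
    "\<And>x::real. x\<^sup>2 = x + 1 \<Longrightarrow> (\<Sum>i\<in>S. x powi i) = real n" by blast
  obtain T where "finite T" "nonadj T" and
    T: "\<And>x::real. x\<^sup>2 = x + 1 \<Longrightarrow> (\<Sum>i\<in>T. x powi i) = (\<Sum>i\<in>S. x powi i) + x powi 0"
    using nonadj_add_power[OF S(1,2), of 0] by blast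
  moreover have "(\<Sum>i\<in>T. x powi i) = real (Suc n)" if "x\<^sup>2 = x + 1" for x :: real
    using T[OF that] S(3)[OF that] by simp
  ultimately show ?case by blast
qed

section \<open>Size estimates and uniqueness of expansions\<close>

lemma nonadj_sum_less:
  assumes "finite F" "nonadj F" "F \<subseteq> {..k}"
  shows "(\<Sum>i\<in>F. phi powi i) < phi powi (k + 1)"
  using assms
proof (induction "card F" arbitrary: F k rule: less_induct)
  case less
  show ?case
  proof (cases "F = {}")
    case False
    let ?m = "Max F"
    have m: "?m \<in> F" and le: "\<And>i. i \<in> F \<Longrightarrow> i \<le> ?m" using False less.prems by auto
    have "F - {?m} \<subseteq> {..?m - 2}"
    proof
      fix i assume i: "i \<in> F - {?m}"
      then have "i \<noteq> ?m - 1" using nonadjD'[OF less.prems(2) m] by auto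
      then show "i \<in> {..?m - 2}" using le[of i] i by auto
    qed
    moreover have "card (F - {?m}) < card F" using m less.prems by (meson card_Diff1_less)
    ultimately have "(\<Sum>i\<in>F - {?m}. phi powi i) < phi powi (?m - 2 + 1)"
      using less.prems by (intro less.hyps) (auto intro: nonadj_subset)
    then have "(\<Sum>i\<in>F. phi powi i) < phi powi (?m + 1)"
      using phi_powi_Suc[of ?m] sum.remove[OF less.prems(1) m, of "\<lambda>i. phi powi i"]
      by simp
    also have "\<dots> \<le> phi powi (k + 1)"
      using m less.prems by (intro phi_powi_mono) auto
    finally show ?thesis .
  qed simp
qed

text \<open>A strict bound on finite sums may become an equality in the limit. A missing member of
  the progression k, k - 2, ... costs an amount independent of \<open>F\<close>, which keeps the
  bound strict for infinite sums.\<close>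

lemma nonadj_sum_gap:
  assumes "finite F" "nonadj F" "F \<subseteq> {..k}" "k - 2 * int j \<notin> F"
  shows "(\<Sum>i\<in>F. phi powi i) \<le> phi powi (k + 1) - phi powi (k - 2 * int j - 1)"
  using assms
proof (induction j arbitrary: F k)
  case 0
  then have "F \<subseteq> {..k - 1}" by (auto simp: order_le_less)
  then show ?case
    using nonadj_sum_less[of F "k - 1"] 0 phi_powi_Suc[of k] by simp
next
  case (Suc j)
  show ?case
  proof (cases "k \<in> F")
    case True
    have "F - {k} \<subseteq> {..k - 2}"
    proof
      fix i assume i: "i \<in> F - {k}"
      then have "i \<noteq> k - 1" using nonadjD'[OF Suc.prems(2) True] by auto
      then show "i \<in> {..k - 2}" using i Suc.prems(3) by force
    qed
    then have "(\<Sum>i\<in>F - {k}. phi powi i) \<le> phi powi (k - 2 + 1) - phi powi (k - 2 - 2 * int j - 1)"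
      using Suc.prems by (intro Suc.IH) (auto intro: nonadj_subset simp: algebra_simps)
    then show ?thesis
      using phi_powi_Suc[of k] sum.remove[OF Suc.prems(1) True, of "\<lambda>i. phi powi i"]
      by (simp add: algebra_simps)
  next
    case False
    then have "F \<subseteq> {..k - 1}" using Suc.prems(3) by (auto simp: order_le_less)
    then have "(\<Sum>i\<in>F. phi powi i) < phi powi k"
      using nonadj_sum_less[of F "k - 1"] Suc.prems by simp
    moreover have "phi powi (k - 2 * int (Suc j) - 1) \<le> phi powi (k - 1)"
      by (intro phi_powi_mono) auto
    ultimately show ?thesis using phi_powi_Suc[of k] by simp
  qed
qed

text \<open>The zeros of a tail 1010... follow from \<open>nonadj\<close>, so such tails are
  excluded by asking that every progression k, k - 2, k - 4, ... misses the set somewhere.\<close>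

definition phi_support :: "real \<Rightarrow> int set \<Rightarrow> bool" where
  "phi_support x E \<longleftrightarrow> nonadj E \<and> bdd_above E \<and> ((\<lambda>i. phi powi i) has_sum x) E \<and>
     (\<forall>k. \<exists>j::nat. k - 2 * int j \<notin> E)"

lemma phi_support_less:
  assumes "nonadj E" "E \<subseteq> {..k}" "((\<lambda>i. phi powi i) has_sum x) E" "k - 2 * int j \<notin> E"
  shows "x < phi powi (k + 1)"
proof -
  have "x \<le> phi powi (k + 1) - phi powi (k - 2 * int j - 1)"
    using assms(3)
  proof (rule has_sum_le_finite_sums)
    fix F assume "finite F" "F \<subseteq> E"
    then show "(\<Sum>i\<in>F. phi powi i) \<le> phi powi (k + 1) - phi powi (k - 2 * int j - 1)"
      using assms by (intro nonadj_sum_gap) (auto intro: nonadj_subset)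
  qed
  then show ?thesis using phi_powi_pos[of "k - 2 * int j - 1"] by linarith
qed

text \<open>Subtract the common part above \<open>m\<close>, which is finite. The rest of
  \<open>E\<close> has value at least phi^m, while the rest of \<open>E'\<close> lies below
  \<open>m\<close> and has value less than phi^m; but both values are the same.\<close>

lemma phi_support_common_upper_part:
  assumes "phi_support x E" "phi_support x E'" "m \<in> E" "m \<notin> E'"
    and eq: "\<And>i. i > m \<Longrightarrow> i \<in> E \<longleftrightarrow> i \<in> E'"
  shows False
proof -
  let ?H = "E \<inter> {m<..}"
  obtain t where t: "\<And>i. i \<in> E \<Longrightarrow> i \<le> t"
    using assms(1) by (auto simp: phi_support_def bdd_above_def)
  have "?H \<subseteq> {m..t}" using t by auto
  then have finH: "finite ?H" by (rule finite_subset) simp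
  let ?h = "\<Sum>i\<in>?H. phi powi i"
  have H: "((\<lambda>i. phi powi i) has_sum ?h) ?H" using finH by (rule has_sum_finite)
  have "((\<lambda>i. phi powi i) has_sum (x - ?h)) (E - ?H)"
    using assms(1) H by (intro has_sum_Diff) (auto simp: phi_support_def)
  moreover have "((\<lambda>i. phi powi i) has_sum (phi powi m)) {m}"
    using has_sum_finite[of "{m}" "\<lambda>i. phi powi i"] by simp
  ultimately have 1: "phi powi m \<le> x - ?h"
    using assms(3) by (intro has_sum_mono2[of "\<lambda>i. phi powi i" "{m}" "phi powi m" "E - ?H" "x - ?h"])
      (auto intro: less_imp_le)
  have "((\<lambda>i. phi powi i) has_sum (x - ?h)) (E' - ?H)"
    using assms(2) H eq by (intro has_sum_Diff) (auto simp: phi_support_def)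
  moreover obtain j where "m - 1 - 2 * int j \<notin> E'" 
    using assms(2) by (auto simp: phi_support_def)
  moreover have "E' - ?H \<subseteq> {..m - 1}"
    using eq assms(4) by (smt (verit) Diff_iff IntI atMost_iff greaterThan_iff subsetI)
  ultimately have "x - ?h < phi powi (m - 1 + 1)"
    using assms(2) nonadj_subset[of E' "E' - ?H"]
    by (intro phi_support_less[of "E' - ?H" _ _ j]) (auto simp: phi_support_def)
  with 1 show False by simp
qed

lemma phi_support_unique:
  assumes "phi_support x E" "phi_support x E'"
  shows "E = E'"
proof (rule ccontr)
  assume "E \<noteq> E'"
  let ?D = "(E - E') \<union> (E' - E)"
  obtain d where d: "d \<in> ?D" using \<open>E \<noteq> E'\<close> by blast
  have "bdd_above (E \<union> E')" using assms by (simp add: phi_support_def)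
  then obtain t where t: "\<And>i. i \<in> E \<union> E' \<Longrightarrow> i \<le> t" by (auto simp: bdd_above_def)
  \<comment> \<open>\<open>?D\<close> may extend infinitely far down; cutting it off at one of its
    elements makes it finite and keeps its maximum.\<close>
  let ?F = "?D \<inter> {d..t}"
  have fin: "finite ?F" by simp
  have ne: "?F \<noteq> {}" using d t by fastforce
  define m where "m = Max ?F"
  have m: "m \<in> ?F" unfolding m_def using fin ne by (rule Max_in)
  have "i \<in> E \<longleftrightarrow> i \<in> E'" if "i > m" for i
  proof (rule ccontr)
    assume "(i \<in> E) \<noteq> (i \<in> E')"
    then have "i \<in> ?F" using m that t[of i] by auto
    then have "i \<le> m" unfolding m_def using fin by (rule Max_ge[rotated])
    then show False using that by simp
  qed
  then show False
    using phi_support_common_upper_part[OF assms, of m]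
      phi_support_common_upper_part[OF assms(2,1), of m] m by blast
qed

lemma is_phi_rep_iff:
  "is_phi_rep x e \<longleftrightarrow> phi_support x {i. e i = 1} \<and> (\<forall>i. e i = of_bool (e i = 1))"
proof (cases "\<forall>i. e i \<in> {0, 1}")
  case False
  then obtain i where "e i \<noteq> 0" "e i \<noteq> 1" by auto
  then have "e i \<noteq> of_bool (e i = 1)" by simp
  then show ?thesis using False unfolding is_phi_rep_def by blast
next
  case True
  let ?E = "{i. e i = 1}"
  have e01: "e i = of_bool (e i = 1)" for i using True by (cases "e i = 1") auto
  have z: "e i = 0 \<longleftrightarrow> e i \<noteq> 1" for i using True[rule_format, of i] by auto
  have sp: "(\<forall>i. e i * e (i + 1) = 0) \<longleftrightarrow> nonadj ?E"
  proof -
    have "e i * e (i + 1) = 0 \<longleftrightarrow> \<not> (e i = 1 \<and> e (i + 1) = 1)" for i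
      using True[rule_format, of i] True[rule_format, of "i + 1"] by auto
    then show ?thesis unfolding nonadj_def by simp
  qed
  have sums: "(\<exists>t. (\<forall>i>t. e i = 0) \<and> ((\<lambda>i. real (e i) * phi powi i) has_sum x) {..t}) \<longleftrightarrow>
      bdd_above ?E \<and> ((\<lambda>i. phi powi i) has_sum x) ?E"
  proof -
    have "(\<forall>i>t. e i = 0) \<longleftrightarrow> ?E \<subseteq> {..t}" for t
      unfolding subset_iff mem_Collect_eq atMost_iff z by (meson not_le)
    moreover have "((\<lambda>i. real (e i) * phi powi i) has_sum x) {..t} \<longleftrightarrow>
        ((\<lambda>i. phi powi i) has_sum x) ?E" if "?E \<subseteq> {..t}" for t
      using that z by (intro has_sum_cong_neutral) auto
    ultimately show ?thesis unfolding bdd_above_def by blast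
  qed
  have tail: "(\<exists>k. \<forall>j::nat. e (k - 2 * int j) = 1 \<and> e (k - 2 * int j - 1) = 0) \<longleftrightarrow>
      (\<exists>k. \<forall>j::nat. k - 2 * int j \<in> ?E)" if "nonadj ?E"
  proof -
    have "e (i - 1) = 0" if "e i = 1" for i
      using nonadjD'[OF \<open>nonadj ?E\<close>, of i] True[rule_format, of "i - 1"] that by auto
    then show ?thesis by auto
  qed
  have e: "\<forall>i. e i = of_bool (e i = 1)" using e01 by blast
  show ?thesis
  proof (cases "nonadj ?E")
    case nonadj: True
    show ?thesis
      unfolding is_phi_rep_def phi_support_def sp sums tail[OF nonadj] eqTrueI[OF True] eqTrueI[OF e]
      by simp
  next
    case False
    then show ?thesis unfolding is_phi_rep_def phi_support_def sp by simp
  qed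
qed

lemma finite_phi_support:
  assumes "finite T" "nonadj T"
  shows "phi_support (\<Sum>i\<in>T. phi powi i) T"
proof -
  have "\<exists>j::nat. k - 2 * int j \<notin> T" for k
  proof (rule ccontr)
    assume "\<not> ?thesis"
    then have "(\<lambda>j::nat. k - 2 * int j) ` UNIV \<subseteq> T" by auto
    then have "finite ((\<lambda>j::nat. k - 2 * int j) ` UNIV)" using assms finite_subset by blast
    then have "finite (UNIV :: nat set)" by (rule finite_imageD) (auto simp: inj_on_def)
    then show False by simp
  qed
  then show ?thesis using assms by (auto simp: phi_support_def intro: has_sum_finite)
qed

lemma phi_exponents_eq:
  assumes "finite T" "nonadj T" "(\<Sum>i\<in>T. phi powi i) = x"
  shows "phi_exponents x = T"
proof -
  have T: "phi_support x T" using finite_phi_support assms by blast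
  have "phi_rep x = (\<lambda>i. of_bool (i \<in> T))"
    unfolding phi_rep_def
  proof (rule the_equality)
    show "is_phi_rep x (\<lambda>i. of_bool (i \<in> T))"
      unfolding is_phi_rep_iff using T by simp
  next
    fix e assume "is_phi_rep x e"
    then have "{i. e i = 1} = T" and e: "\<And>i. e i = of_bool (e i = 1)"
      using T phi_support_unique unfolding is_phi_rep_iff by blast+
    then have mem: "e i = 1 \<longleftrightarrow> i \<in> T" for i by blast
    show "e = (\<lambda>i. of_bool (i \<in> T))" using e unfolding mem by (rule ext)
  qed
  then show ?thesis by (simp add: phi_exponents_def)
qed

lemma nonadj_sum_inject:
  assumes "finite S" "nonadj S" "finite T" "nonadj T"
    "(\<Sum>i\<in>S. phi powi i) = (\<Sum>i\<in>T. phi powi i)"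
  shows "S = T"
  using phi_exponents_eq assms by metis

section \<open>Expansions with one odd exponent\<close>

lemma nonadj_even: "(\<And>i. i \<in> E \<Longrightarrow> even i) \<Longrightarrow> nonadj E"
  unfolding nonadj_def by (metis even_plus_one_iff)

text \<open>Turns the equation at \<open>psi\<close> into one between powers of \<open>phi\<close>
  with reflected exponents; the sign at odd exponents moves the odd digit to the other side.\<close>

lemma conjugate_powi:
  "psi powi i = (if even i then phi powi (- i) else - (phi powi (- i)))"
proof -
  have "psi = - inverse phi" by (simp add: field_simps)
  then show ?thesis
    by (simp add: power_int_minus_left power_int_inverse power_int_minus)
qed

text \<open>Apply phi^k + phi^(k+1) = phi^(k+2) upwards until the next even exponent is absent. That
  all even exponents passed on the way were present is recorded because it later rules out a carry
  that ends at \<open>d\<close>.\<close>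

lemma carry_odd_power:
  assumes "finite E" "\<And>i. i \<in> E \<Longrightarrow> even i" "odd k"
  shows "\<exists>k'\<ge>k. odd k' \<and> k' + 1 \<notin> E \<and> (\<forall>i. even i \<and> k < i \<and> i < k' \<longrightarrow> i \<in> E) \<and>
    (\<Sum>i\<in>E. phi powi i) + phi powi k = (\<Sum>i\<in>E - {k<..<k'}. phi powi i) + phi powi k'"
  using assms
proof (induction "card E" arbitrary: E k rule: less_induct)
  case less
  show ?case
  proof (cases "k + 1 \<in> E")
    case False
    moreover have "{k<..<k} = {}" by simp
    ultimately show ?thesis using less.prems by (intro exI[of _ k]) auto
  next
    case True
    let ?E = "E - {k + 1}"
    have "card ?E < card E" using True less.prems by (meson card_Diff1_less)
    then obtain k' where k': "k' \<ge> k + 2" "odd k'" "k' + 1 \<notin> ?E"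
      "\<And>i. even i \<Longrightarrow> k + 2 < i \<Longrightarrow> i < k' \<Longrightarrow> i \<in> ?E"
      "(\<Sum>i\<in>?E. phi powi i) + phi powi (k + 2) = (\<Sum>i\<in>?E - {k + 2<..<k'}. phi powi i) + phi powi k'"
      using less.hyps[of ?E "k + 2"] less.prems by auto
    have "i \<in> E" if "even i" "k < i" "i < k'" for i
    proof -
      have "i \<noteq> k + 2" using that less.prems(3) by auto
      then have "i = k + 1 \<or> k + 2 < i" using that by linarith
      then show ?thesis using True k'(4)[of i] that by blast
    qed
    moreover have "?E - {k + 2<..<k'} = E - {k<..<k'}"
    proof -
      have "k + 2 \<notin> E" using less.prems(2)[of "k + 2"] less.prems(3) by auto
      then show ?thesis using k'(1) by (auto simp: not_less) (smt (verit))+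
    qed
    moreover have "(\<Sum>i\<in>E. phi powi i) + phi powi k = (\<Sum>i\<in>?E. phi powi i) + phi powi (k + 2)"
      using sum.remove[OF less.prems(1) True, of "\<lambda>i. phi powi i"] phi_powi[of k] by simp
    moreover have "k' + 1 \<notin> E" using k'(1,3) by auto
    ultimately show ?thesis using k'(1,2,5) by (intro exI[of _ k']) auto
  qed
qed

text \<open>The exponents 1 and -2 come from 2 = phi + phi^(-2), the pairs from L_(2i) = phi^(2i) +
  phi^(-2i).\<close>

definition lucas_exponents :: "nat set \<Rightarrow> int set" where
  "lucas_exponents S = {1, - 2} \<union> ((\<lambda>i. 2 * int i) ` S \<union> (\<lambda>i. - 2 * int i) ` S)"

lemma one_odd_exponent_shape:
  assumes fin: "finite T" and nonadj: "nonadj T"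
    and sums: "\<And>x::real. x\<^sup>2 = x + 1 \<Longrightarrow> (\<Sum>i\<in>T. x powi i) = real n"
    and card: "card {i \<in> T. odd i} = 1"
  obtains S where "finite S" "S \<subseteq> {2..}" "T = lucas_exponents S"
proof -
  obtain d where d: "{i \<in> T. odd i} = {d}" using card card_1_singletonE by blast
  then have dT: "d \<in> T" and odd: "odd d" by auto
  define E where "E = T - {d}"
  have T: "T = insert d E" and dE: "d \<notin> E" and finE: "finite E"
    using dT fin by (auto simp: E_def)
  have even: "even i" if "i \<in> E" for i using that d unfolding E_def by blast
  have d1: "d + 1 \<notin> E" "d - 1 \<notin> E"
    using nonadj unfolding T by (simp_all add: nonadj_insert)
  define N where "N = uminus ` E"
  have evenN: "even i" if "i \<in> N" for i using that even by (auto simp: N_def)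
  \<comment> \<open>Eliminate n between n = value(E) + phi^d, the equation at \<open>phi\<close>,
    and n = value(N) - phi^(-d), the equation at \<open>psi\<close>.\<close>
  have sumN: "(\<Sum>i\<in>N. phi powi i) = (\<Sum>i\<in>E. phi powi i) + phi powi (- d) + phi powi d"
  proof -
    have "phi powi (- i) = psi powi i" if "i \<in> E" for i
      unfolding conjugate_powi using even[OF that] by simp
    then have "(\<Sum>i\<in>N. phi powi i) = (\<Sum>i\<in>E. psi powi i)"
      unfolding N_def by (subst sum.reindex) (simp, unfold o_def, rule sum.cong, simp_all only:)
    also have "\<dots> = real n + phi powi (- d)"
    proof -
      have "psi powi d = - (phi powi (- d))"
        unfolding conjugate_powi using odd by simp
      then show ?thesis
        using sums[OF conjugate_square] sum.insert[OF finE dE, of "\<lambda>i. psi powi i"]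
        unfolding T by linarith
    qed
    finally show ?thesis
      using sums[OF phi_square] dE finE by (simp add: T)
  qed
  \<comment> \<open>Since \<open>N\<close> has only even exponents, a candidate \<open>W\<close>
    containing the odd \<open>d\<close> is contradictory. This is used twice; a third candidate then
    determines \<open>N\<close>.\<close>
  have N_unique: "W = N" if "finite W" "nonadj W"
    "(\<Sum>i\<in>W. phi powi i) = (\<Sum>i\<in>E. phi powi i) + phi powi (- d) + phi powi d" for W
    using that finE evenN sumN
    by (intro nonadj_sum_inject) (auto simp: N_def intro: nonadj_even)
  obtain k where k: "k \<ge> - d" "odd k" "k + 1 \<notin> E"
      "\<And>i. even i \<Longrightarrow> - d < i \<Longrightarrow> i < k \<Longrightarrow> i \<in> E"
      "(\<Sum>i\<in>E. phi powi i) + phi powi (- d) = (\<Sum>i\<in>E - {- d<..<k}. phi powi i) + phi powi k"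
    using carry_odd_power[OF finE even, of "- d"] odd by auto
  let ?E = "E - {- d<..<k}"
  \<comment> \<open>A carry from -d up to d > 0 would have passed d - 1, which cannot be an exponent
    next to d.\<close>
  have "k \<noteq> d"
  proof
    assume "k = d"
    moreover have "d > 0" using k(1) odd \<open>k = d\<close> by (cases "d = 0") auto
    ultimately show False using k(4)[of "d - 1"] d1 odd by auto
  qed
  \<comment> \<open>Otherwise phi^k and phi^d can both be inserted without adjacency, which leaves
    the odd exponent \<open>d\<close>.\<close>
  have k1: "k - 1 \<in> ?E"
  proof (rule ccontr)
    assume nk: "k - 1 \<notin> ?E"
    let ?W = "insert k (insert d ?E)"
    have "k \<notin> E" using k(2) even by blast
    have "nonadj ?E" using even by (intro nonadj_even) auto
    then have "nonadj ?W" using nk k(2,3) d1 odd by (auto simp: nonadj_insert)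
    moreover have "(\<Sum>i\<in>?W. phi powi i) = (\<Sum>i\<in>E. phi powi i) + phi powi (- d) + phi powi d"
      using k(5) \<open>k \<noteq> d\<close> \<open>k \<notin> E\<close> dE finE by simp
    ultimately have "?W = N" using finE by (intro N_unique) auto
    then show False using evenN[of d] odd by blast
  qed
  \<comment> \<open>After a genuine carry, k - 1 would be among the absorbed exponents.\<close>
  have kd: "k = - d"
  proof (rule ccontr)
    assume "k \<noteq> - d"
    then have "k - 1 > - d" using k(1,2) odd by presburger
    then show False using k1 by simp
  qed
  have m: "- d - 1 \<in> E" "- d + 1 \<notin> E" using k1 k(3) kd by auto
  have split: "(\<Sum>i\<in>E. phi powi i) = phi powi (- d - 1) + (\<Sum>i\<in>E - {- d - 1}. phi powi i)"
    using finE m(1) by (rule sum.remove)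
  \<comment> \<open>Merge phi^(-d-1) + phi^(-d) into phi^(-d+1). By parity this new even exponent is
    adjacent to d only if d = 1; otherwise d survives in the normal form.\<close>
  have d_eq: "d = 1"
  proof (rule ccontr)
    assume "d \<noteq> 1"
    let ?W = "insert d (insert (- d + 1) (E - {- d - 1}))"
    have "nonadj (insert (- d + 1) (E - {- d - 1}))"
      using even odd by (intro nonadj_even) auto
    moreover have "d + 1 \<noteq> - d + 1" using odd by auto
    ultimately have "nonadj ?W" using d1 \<open>d \<noteq> 1\<close> by (auto simp: nonadj_insert)
    moreover have "d \<noteq> - d + 1" using odd by presburger
    then have "(\<Sum>i\<in>?W. phi powi i) = (\<Sum>i\<in>E. phi powi i) + phi powi (- d) + phi powi d"
      using finE dE m(2) split phi_powi_Suc[of "- d"] by simp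
    ultimately have "?W = N" using finE by (intro N_unique) auto
    then show False using evenN[of d] odd by blast
  qed
  have E0: "0 \<notin> E" "2 \<notin> E" "- 2 \<in> E" using d1 m d_eq by auto
  \<comment> \<open>The two carries phi^(-2) + phi^(-1) = 1 and 1 + phi = phi^2 absorb both added
    powers.\<close>
  have N: "N = insert 2 (E - {- 2})"
  proof (rule N_unique[symmetric])
    show "nonadj (insert 2 (E - {- 2}))" using even by (intro nonadj_even) auto
    have "phi powi 2 = phi powi 1 + phi powi 0" "phi powi 0 = phi powi (- 1) + phi powi (- 2)"
      using phi_powi_Suc[of 1] phi_powi_Suc[of "- 1"] by simp_all
    then show "(\<Sum>i\<in>insert 2 (E - {- 2}). phi powi i) =
        (\<Sum>i\<in>E. phi powi i) + phi powi (- d) + phi powi d"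
      using split finE E0 d_eq by simp
  qed (use finE in simp)
  have reflect: "- i \<in> E \<longleftrightarrow> i \<in> E" if "i \<noteq> 2" "i \<noteq> - 2" for i
  proof -
    have "- i \<in> E \<longleftrightarrow> i \<in> N" unfolding N_def by force
    also have "\<dots> \<longleftrightarrow> i \<in> E" unfolding N using that by blast
    finally show ?thesis .
  qed
  define S where "S = {i::nat. i \<ge> 2 \<and> 2 * int i \<in> E}"
  have "(\<lambda>i. 2 * int i) ` S \<subseteq> E" by (auto simp: S_def)
  then have "finite ((\<lambda>i. 2 * int i) ` S)" using finE by (rule finite_subset)
  then have "finite S" by (rule finite_imageD) (simp add: inj_on_def)
  moreover have "E = insert (- 2) ((\<lambda>i. 2 * int i) ` S \<union> (\<lambda>i. - 2 * int i) ` S)" (is "_ = ?R")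
  proof
    show "E \<subseteq> ?R"
    proof
      fix i assume i: "i \<in> E"
      then obtain j where j: "i = 2 * j" using even by blast
      \<comment> \<open>The exponents 0 and 2 are excluded as neighbours of 1.\<close>
      consider "j = - 1" | "j \<ge> 2" | "j \<le> - 2"
        using i j E0 by (smt (verit))
      then show "i \<in> ?R"
      proof cases
        case 2
        then have "nat j \<in> S" using i j by (auto simp: S_def)
        then show ?thesis using 2 j by (force simp: image_iff)
      next
        case 3
        then have "- i \<in> E" using i reflect[of i] j by auto
        then have "nat (- j) \<in> S" using 3 j by (auto simp: S_def)
        then show ?thesis using 3 j by (force simp: image_iff)
      qed (use j in auto)
    qed
    show "?R \<subseteq> E" using E0 reflect by (auto simp: S_def)
  qed
  then have "T = lucas_exponents S" unfolding T d_eq lucas_exponents_def by auto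
  moreover have "S \<subseteq> {2..}" by (auto simp: S_def)
  ultimately show ?thesis using that by blast
qed

section \<open>Lucas sums and their exponent sets\<close>

lemma lucas_golden:
  "real (lucas n) = phi powi (int n) + psi powi (int n)"
proof (induction n rule: lucas.induct)
  case 2
  then show ?case using phi_square phi_gt_1 by (simp add: field_simps power2_eq_square)
next
  case (3 n)
  then show ?case
    using phi_powi[of "int n"] powi_golden_root[OF conjugate_square, of "int n"]
    by (simp add: algebra_simps)
qed simp

lemma lucas_even: "real (lucas (2 * i)) = phi powi (2 * int i) + phi powi (- 2 * int i)"
  unfolding lucas_golden conjugate_powi by simp

lemma finite_lucas_exponents: "finite S \<Longrightarrow> finite (lucas_exponents S)"
  by (simp add: lucas_exponents_def)

lemma odd_lucas_exponents: "i \<in> lucas_exponents S \<Longrightarrow> odd i \<Longrightarrow> i = 1"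
  by (auto simp: lucas_exponents_def)

lemma one_in_lucas_exponents: "1 \<in> lucas_exponents S"
  by (simp add: lucas_exponents_def)

lemma nonadj_lucas_exponents:
  assumes "S \<subseteq> {2..}"
  shows "nonadj (lucas_exponents S)"
proof -
  let ?E = "insert (- 2) ((\<lambda>i. 2 * int i) ` S \<union> (\<lambda>i. - 2 * int i) ` S)"
  have "nonadj ?E" by (rule nonadj_even) auto
  moreover have "0 \<notin> ?E" "2 \<notin> ?E" using assms by auto
  ultimately show ?thesis
    by (simp add: lucas_exponents_def nonadj_insert)
qed

lemma sum_lucas_exponents:
  assumes "finite S" "S \<subseteq> {2..}"
  shows "(\<Sum>i\<in>lucas_exponents S. phi powi i) = 2 + (\<Sum>i\<in>S. real (lucas (2 * i)))"
proof -
  let ?A = "(\<lambda>i. 2 * int i) ` S" and ?B = "(\<lambda>i. - 2 * int i) ` S"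
  have disj: "?A \<inter> ?B = {}" "{1, - 2} \<inter> (?A \<union> ?B) = {}"
    using assms(2) by auto
  have "(\<Sum>i\<in>?A. phi powi i) = (\<Sum>i\<in>S. phi powi (2 * int i))"
    by (subst sum.reindex) (auto simp: inj_on_def)
  moreover have "(\<Sum>i\<in>?B. phi powi i) = (\<Sum>i\<in>S. phi powi (- 2 * int i))"
    by (subst sum.reindex) (auto simp: inj_on_def)
  moreover have "(\<Sum>i\<in>lucas_exponents S. phi powi i) =
      (\<Sum>i\<in>{1, - 2}. phi powi i) + ((\<Sum>i\<in>?A. phi powi i) + (\<Sum>i\<in>?B. phi powi i))"
    unfolding lucas_exponents_def using assms(1) disj by (subst sum.union_disjoint) (auto simp: sum.union_disjoint)
  moreover have "(\<Sum>i\<in>{1, - 2::int}. phi powi i) = 2"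
    using phi_powi_Suc[of 0] phi_powi_Suc[of "- 1"] by simp
  ultimately show ?thesis by (simp add: lucas_even sum.distrib)
qed

lemma phi_exponents_lucas_sum:
  assumes "finite S" "S \<subseteq> {2..}" "int n - 2 = (\<Sum>i\<in>S. int (lucas (2 * i)))"
  shows "phi_exponents (real n) = lucas_exponents S"
proof (rule phi_exponents_eq)
  have "real n - 2 = (\<Sum>i\<in>S. real (lucas (2 * i)))"
    using arg_cong[OF assms(3), of real_of_int] by simp
  then show "(\<Sum>i\<in>lucas_exponents S. phi powi i) = real n"
    using sum_lucas_exponents[OF assms(1,2)] by simp
qed (use assms finite_lucas_exponents nonadj_lucas_exponents in auto)

lemma odd_phi_exponents_lucas_sum:
  assumes "finite S" "S \<subseteq> {2..}" "int n - 2 = (\<Sum>i\<in>S. int (lucas (2 * i)))"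
  shows "{i \<in> phi_exponents (real n). odd i} = {1}"
  using phi_exponents_lucas_sum[OF assms] odd_lucas_exponents one_in_lucas_exponents by auto

text \<open>The subtraction is over the integers, so n = 0 and n = 1 cannot slip in by
  truncation.\<close>

lemma one_odd_exponent_iff_lucas_sum:
  "n \<in> one_odd_exponent \<longleftrightarrow>
     (\<exists>S. finite S \<and> S \<subseteq> {2..} \<and> int n - 2 = (\<Sum>i\<in>S. int (lucas (2 * i))))"
proof
  assume "n \<in> one_odd_exponent"
  then have card: "card {i \<in> phi_exponents (real n). odd i} = 1"
    by (simp add: one_odd_exponent_def)
  obtain T where T: "finite T" "nonadj T"
    "\<And>x::real. x\<^sup>2 = x + 1 \<Longrightarrow> (\<Sum>i\<in>T. x powi i) = real n"
    using nat_nonadj_power_sum by blast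
  have "phi_exponents (real n) = T"
    using T phi_square by (intro phi_exponents_eq) auto
  then obtain S where S: "finite S" "S \<subseteq> {2..}" "T = lucas_exponents S"
    using one_odd_exponent_shape[OF T] card by blast
  have "real n = 2 + (\<Sum>i\<in>S. real (lucas (2 * i)))"
    using T(3)[OF phi_square] sum_lucas_exponents[OF S(1,2)] S(3) by simp
  then have "real_of_int (int n - 2) = real_of_int (\<Sum>i\<in>S. int (lucas (2 * i)))" by simp
  then show "\<exists>S. finite S \<and> S \<subseteq> {2..} \<and> int n - 2 = (\<Sum>i\<in>S. int (lucas (2 * i)))"
    using S of_int_eq_iff by blast
next
  assume "\<exists>S. finite S \<and> S \<subseteq> {2..} \<and> int n - 2 = (\<Sum>i\<in>S. int (lucas (2 * i)))"
  then show "n \<in> one_odd_exponent"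
    using odd_phi_exponents_lucas_sum by (auto simp: one_odd_exponent_def)
qed

section \<open>Zeckendorf words\<close>

text \<open>Weights are indexed from the right end. The weight function is a parameter so that a
  prefix can be evaluated with weights shifted by the length of its suffix.\<close>

fun weighted_sum :: "(nat \<Rightarrow> nat) \<Rightarrow> bool list \<Rightarrow> nat" where
  "weighted_sum f [] = 0"
| "weighted_sum f (b # w) = of_bool b * f (length w) + weighted_sum f w"

abbreviation fib_value :: "bool list \<Rightarrow> nat" where
  "fib_value \<equiv> weighted_sum (\<lambda>i. fib (i + 2))"

abbreviation no_11 :: "bool list \<Rightarrow> bool" where
  "no_11 \<equiv> successively (\<lambda>a b. \<not> (a \<and> b))"

lemma weighted_sum_eq_sum:
  "weighted_sum f w = (\<Sum>j<length w. of_bool (w ! j) * f (length w - Suc j))"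
proof (induction w)
  case (Cons b w)
  show ?case
    unfolding weighted_sum.simps Cons.IH length_Cons sum.lessThan_Suc_shift by simp
qed simp

lemma is_zeckendorf_iff:
  "is_zeckendorf n w \<longleftrightarrow> (w \<noteq> [] \<longrightarrow> hd w) \<and> no_11 w \<and> n = fib_value w"
proof -
  have "fib_value w = (\<Sum>j<length w. of_bool (w ! j) * fib (length w + 1 - j))"
    unfolding weighted_sum_eq_sum
  proof (intro sum.cong refl)
    fix j assume "j \<in> {..<length w}"
    then have "length w - Suc j + 2 = length w + 1 - j" by auto
    then show "of_bool (w ! j) * fib (length w - Suc j + 2) = of_bool (w ! j) * fib (length w + 1 - j)"
      by (simp only:)
  qed
  then show ?thesis unfolding is_zeckendorf_def successively_conv_nth by auto
qed

lemma fib_value_less: "no_11 w \<Longrightarrow> fib_value w < fib (length w + 2)"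
proof (induction w rule: induct_list012)
  case (3 a b w)
  then have "no_11 w" "no_11 (b # w)" "\<not> (a \<and> b)" by (auto simp: successively_Cons)
  then show ?case using 3 by (cases a; cases b) auto
qed auto

lemma fib_value_inject:
  assumes "no_11 w" "no_11 w'" "length w = length w'" "fib_value w = fib_value w'"
  shows "w = w'"
  using assms(3,1,2,4)
proof (induction w w' rule: list_induct2)
  case (Cons b w b' w')
  have "no_11 w" "no_11 w'" using Cons.prems by (auto simp: successively_Cons)
  then have "fib_value w < fib (length w + 2)" "fib_value w' < fib (length w + 2)"
    using fib_value_less Cons.hyps by metis+
  then have "b = b'" using Cons.prems Cons.hyps by (cases b; cases b') auto
  then show ?case using Cons \<open>no_11 w\<close> \<open>no_11 w'\<close> by auto
qed simp

text \<open>A leading 1 alone already outweighs every shorter admissible word.\<close>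

lemma is_zeckendorf_length_le:
  assumes "is_zeckendorf n w" "is_zeckendorf n w'"
  shows "length w \<le> length w'"
proof (rule ccontr)
  assume less: "\<not> ?thesis"
  then obtain v where w: "w = True # v"
    using assms by (cases w) (auto simp: is_zeckendorf_iff)
  have "fib (length w' + 2) \<le> fib (length v + 2)"
    using less w by (intro fib_mono) auto
  then show False
    using assms fib_value_less[of w'] w by (auto simp: is_zeckendorf_iff)
qed

lemma is_zeckendorf_unique: "is_zeckendorf n w \<Longrightarrow> is_zeckendorf n w' \<Longrightarrow> w = w'"
  using is_zeckendorf_length_le[of n w w'] is_zeckendorf_length_le[of n w' w]
  by (intro fib_value_inject) (auto simp: is_zeckendorf_iff)

text \<open>The greedy algorithm. Leading zeros are allowed so that the length can be prescribed in
  the induction; they are stripped in \<open>is_zeckendorf_exists\<close>.\<close>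

lemma fib_value_surj: "n < fib (k + 2) \<Longrightarrow> \<exists>w. length w = k \<and> no_11 w \<and> fib_value w = n"
proof (induction k arbitrary: n rule: induct_nat_012)
  case 0
  then show ?case by (intro exI[of _ "[]"]) auto
next
  case 1
  then have "n = 0 \<or> n = 1" by (auto simp: numeral_eq_Suc)
  then show ?case
    by (elim disjE) (intro exI[of _ "[False]"] exI[of _ "[True]"]; auto)+
next
  case (ge2 k)
  show ?case
  proof (cases "n < fib (Suc k + 2)")
    case True
    then obtain w where "length w = Suc k" "no_11 w" "fib_value w = n" using ge2.IH by blast
    then show ?thesis by (intro exI[of _ "False # w"]) (auto simp: successively_Cons)
  next
    case False
    then have "n - fib (k + 3) < fib (k + 2)" using ge2.prems by (simp add: numeral_eq_Suc)
    then obtain w where "length w = k" "no_11 w" "fib_value w = n - fib (k + 3)"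
      using ge2.IH by blast
    then show ?thesis using False
      by (intro exI[of _ "True # False # w"]) (auto simp: successively_Cons numeral_eq_Suc)
  qed
qed

lemma less_fib: "n < fib (n + 2)"
proof (induction n)
  case (Suc n)
  have "fib (Suc n) > 0" by (rule fib_neq_0_nat) simp
  then show ?case using Suc by simp
qed simp

lemma is_zeckendorf_exists: "\<exists>w. is_zeckendorf n w"
proof -
  obtain w where w: "no_11 w" "fib_value w = n" using fib_value_surj less_fib by blast
  have "no_11 (dropWhile Not w) \<and> fib_value (dropWhile Not w) = fib_value w"
    using w(1) by (induction w) (auto simp: successively_Cons)
  moreover have "dropWhile Not w \<noteq> [] \<longrightarrow> hd (dropWhile Not w)"
    using hd_dropWhile[of Not w] by auto
  ultimately show ?thesis using w unfolding is_zeckendorf_iff by metis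
qed

lemma zeckendorf_image:
  "zeckendorf ` U = {w. (w \<noteq> [] \<longrightarrow> hd w) \<and> no_11 w \<and> fib_value w \<in> U}"
proof -
  have "is_zeckendorf n (zeckendorf n)" for n
    unfolding zeckendorf_def using is_zeckendorf_exists is_zeckendorf_unique by (metis (mono_tags) theI)
  then have "zeckendorf ` U = {w. \<exists>n\<in>U. is_zeckendorf n w}"
    using is_zeckendorf_unique by (auto simp: image_iff) blast+
  then show ?thesis by (auto simp: is_zeckendorf_iff)
qed

section \<open>Regularity\<close>

text \<open>One direction of Myhill-Nerode: \<open>f\<close> determines the residual of a word, so
  there are finitely many residuals, and these, coded as natural numbers, are the states.\<close>

lemma regular_language_finite_classes:
  fixes f :: "'a :: finite list \<Rightarrow> 'c"
  assumes fin: "finite (range f)"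
    and cong: "\<And>u u' v. f u = f u' \<Longrightarrow> u @ v \<in> A \<longleftrightarrow> u' @ v \<in> A"
  shows "regular_language A"
proof -
  define res where "res u = {v. u @ v \<in> A}" for u
  have "res u = res (inv f (f u))" for u
    using cong[of u "inv f (f u)"] by (auto simp: res_def f_inv_into_f)
  then have "range res \<subseteq> (\<lambda>c. res (inv f c)) ` range f" by blast
  then have "finite (range res)" using fin by (meson finite_imageI finite_subset)
  then obtain h :: "'a list set \<Rightarrow> nat" where h: "inj_on h (range res)"
    using finite_imp_inj_to_nat_seg by metis
  define M where "M = \<lparr>states = h ` range res, init = h (res []),
    trans_fun = (\<lambda>q a. h {v. a # v \<in> inv_into (range res) h q}),
    accepting = h ` {X \<in> range res. [] \<in> X}\<rparr>"
  have step: "trans_fun M (h (res u)) a = h (res (u @ [a]))" for u a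
    using h by (simp add: M_def res_def)
  have "is_dfa M"
    unfolding is_dfa_def using \<open>finite (range res)\<close> step by (auto simp: M_def)
  moreover have run: "foldl (trans_fun M) (init M) w = h (res w)" for w
  proof (induction w rule: rev_induct)
    case Nil
    then show ?case by (simp add: M_def)
  qed (simp add: step)
  have "w \<in> dfa_language M \<longleftrightarrow> w \<in> A" for w
  proof -
    have "h (res w) \<in> accepting M \<longleftrightarrow> [] \<in> res w"
      using h by (auto simp: M_def inj_on_def)
    then show ?thesis unfolding dfa_language_def mem_Collect_eq run by (simp add: res_def)
  qed
  ultimately show ?thesis unfolding regular_language_def by blast
qed

section \<open>Growth and contraction of Fibonacci-like sequences\<close>

lemma phi_less_2: "phi < 2"
  unfolding golden_ratio_def by (simp add: real_sqrt_less_iff[of 5 9, simplified])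

text \<open>This linear form is an eigenvector of the recurrence with eigenvalue \<open>psi\<close>,
  hence it contracts.\<close>

lemma golden_recurrence:
  fixes c :: "nat \<Rightarrow> nat"
  assumes "\<And>i. c (Suc (Suc i)) = c (Suc i) + c i"
  shows "c (Suc i) * psi + c i = psi ^ i * (c (Suc 0) * psi + c 0)"
proof (induction i)
  case (Suc i)
  have "c (Suc (Suc i)) * psi + c (Suc i) = c (Suc i) * (psi + 1) + c i * psi"
    by (simp add: assms algebra_simps)
  also have "\<dots> = psi * (c (Suc i) * psi + c i)"
    unfolding conjugate_square[symmetric] by (simp add: power2_eq_square algebra_simps)
  finally show ?case unfolding Suc by simp
qed simp

lemma fib_golden: "fib (Suc n) - psi * fib n = phi ^ n"
proof (induction n)
  case (Suc n)
  have 1: "1 - psi = phi" "phi * psi = - 1"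
    using phi_square phi_gt_1 by (simp_all add: field_simps power2_eq_square)
  have "fib (Suc (Suc n)) - psi * fib (Suc n) = (1 - psi) * fib (Suc n) + fib n"
    by (simp add: algebra_simps)
  also have "\<dots> = phi * fib (Suc n) - (phi * psi) * fib n" unfolding 1 by simp
  also have "\<dots> = phi * (fib (Suc n) - psi * fib n)" by (simp add: algebra_simps)
  finally show ?case unfolding Suc by simp
qed simp

lemma golden_growth:
  fixes c :: "nat \<Rightarrow> nat"
  assumes "\<And>i. c (Suc (Suc i)) = c (Suc i) + c i" "c 0 \<le> K" "c (Suc 0) \<le> K * phi"
  shows "c n \<le> K * phi ^ n"
proof (induction n rule: induct_nat_012)
  case (ge2 n)
  have "K * phi ^ Suc (Suc n) = K * phi ^ n * phi\<^sup>2" by (simp add: power2_eq_square)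
  also have "\<dots> = K * phi ^ Suc n + K * phi ^ n" unfolding phi_square by (simp add: algebra_simps)
  finally show ?case using ge2 by (simp add: assms(1))
qed (use assms in auto)

lemma fib_le_phi_power: "fib n \<le> phi ^ n"
  using golden_growth[of fib 1] phi_gt_1 by simp

lemma lucas_le_phi_power: "lucas n \<le> 2 * phi ^ n"
  using golden_growth[of lucas 2] phi_gt_1 by simp

lemma sum_lucas: "Suc (\<Sum>j<n. lucas j) = lucas (Suc n)"
  by (induction n) auto

lemma abs_psi_power: "\<bar>psi ^ i\<bar> = (1 / phi) ^ i"
  using phi_gt_1 by (simp add: power_abs)

text \<open>The full geometric series has value phi + 1 < 3, whatever \<open>I\<close> is.\<close>

lemma sum_psi_power_le:
  assumes "finite I"
  shows "(\<Sum>i\<in>I. \<bar>psi ^ i\<bar>) \<le> 3"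
proof -
  have c: "norm (1 / phi) < 1" using phi_gt_1 by simp
  have "(\<Sum>i\<in>I. (1 / phi) ^ i) \<le> (\<Sum>i. (1 / phi) ^ i)"
    using c assms phi_gt_1 by (intro sum_le_suminf summable_geometric) auto
  also have "\<dots> = 1 / (1 - 1 / phi)" using c by (rule suminf_geometric)
  also have "\<dots> = phi + 1"
    using phi_square phi_gt_1 by (simp add: field_simps power2_eq_square)
  finally show ?thesis unfolding abs_psi_power using phi_less_2 by simp
qed

section \<open>Splitting values at the end of a prefix\<close>

lemma lucas_add: "lucas (m + 2 + i) = lucas (Suc i) * fib (m + 2) + lucas i * fib (Suc m)"
proof (induction i rule: induct_nat_012)
  case 0
  show ?case by (induction m rule: induct_nat_012) auto
next
  case 1
  show ?case by (induction m rule: induct_nat_012) auto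
next
  case (ge2 i)
  then show ?case by (simp add: algebra_simps)
qed

lemma weighted_sum_append:
  "weighted_sum f (u @ v) = weighted_sum (\<lambda>i. f (length v + i)) u + weighted_sum f v"
  by (induction u) (auto simp: add.commute)

lemma weighted_sum_combine:
  "weighted_sum (\<lambda>i. f i * a + g i * b) u = weighted_sum f u * a + weighted_sum g u * b"
  by (induction u) (auto simp: algebra_simps)

text \<open>Together with \<open>lucas_add\<close>, this expresses the prefix and the high Lucas
  numbers in the same two consecutive Fibonacci numbers.\<close>

lemma fib_value_append:
  "fib_value (u @ v) = weighted_sum (\<lambda>i. fib (Suc i)) u * fib (length v + 2) +
     weighted_sum fib u * fib (Suc (length v)) + fib_value v"
proof -
  have "fib (length v + i + 2) = fib (Suc i) * fib (length v + 2) + fib i * fib (Suc (length v))" for i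
    using fib_add[of "Suc (length v)" i] by (simp add: algebra_simps)
  then show ?thesis unfolding weighted_sum_append by (simp only: weighted_sum_combine)
qed

text \<open>Suppose that \<open>m \<equiv> r\<close> (mod 2) digits follow the prefix \<open>u\<close>, and subtract from its value a set of
  Lucas numbers with even indices \<open>m + 2 + i\<close>, \<open>i \<in> I\<close>. The difference is \<open>p * fib (m + 2) + q * fib (m + 1)\<close>
  with a pair \<open>(p, q)\<close> from the following set, which depends on \<open>m\<close> only through \<open>r\<close>.\<close>

definition discrepancies :: "bool list \<Rightarrow> nat \<Rightarrow> (int \<times> int) set" where
  "discrepancies u r =
     (\<lambda>I. (int (weighted_sum (\<lambda>i. fib (Suc i)) u) - (\<Sum>i\<in>I. int (lucas (Suc i))),
           int (weighted_sum fib u) - (\<Sum>i\<in>I. int (lucas i)))) `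
       {I. finite I \<and> (\<forall>i\<in>I. i mod 2 = r)}"

text \<open>Position i contributes at most |psi^i| for a digit of the word and at most 2 |psi^i| for
  a Lucas number, whence 9 = 3 + 2 * 3.\<close>

lemma discrepancy_conjugate_bound:
  assumes "(p, q) \<in> discrepancies u r"
  shows "\<bar>p * psi + q\<bar> \<le> 9"
proof -
  have psi: "\<bar>psi\<bar> \<le> 1" "-1 \<le> psi" "psi \<le> 0" using phi_gt_1 by auto
  obtain I where I: "finite I" and
    p: "p = int (weighted_sum (\<lambda>i. fib (Suc i)) u) - (\<Sum>i\<in>I. int (lucas (Suc i)))" and
    q: "q = int (weighted_sum fib u) - (\<Sum>i\<in>I. int (lucas i))"
    using assms by (auto simp: discrepancies_def)
  have "\<bar>weighted_sum (\<lambda>i. fib (Suc i)) u * psi + weighted_sum fib u\<bar> \<le> (\<Sum>i<length u. \<bar>psi ^ i\<bar>)"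
  proof (induction u)
    case (Cons b u)
    have "\<bar>fib (Suc (length u)) * psi + fib (length u)\<bar> = \<bar>psi ^ length u\<bar> * \<bar>psi\<bar>"
      using golden_recurrence[of fib "length u"] by (simp add: abs_mult)
    also have "\<dots> \<le> \<bar>psi ^ length u\<bar>"
      using psi(1) by (intro mult_left_le) auto
    finally show ?case using Cons by (cases b) (auto simp: algebra_simps)
  qed simp
  then have 1: "\<bar>weighted_sum (\<lambda>i. fib (Suc i)) u * psi + weighted_sum fib u\<bar> \<le> 3"
    using sum_psi_power_le[of "{..<length u}"] by simp
  have "\<bar>\<Sum>i\<in>I. lucas (Suc i) * psi + lucas i\<bar> \<le> (\<Sum>i\<in>I. 2 * \<bar>psi ^ i\<bar>)"
  proof (rule sum_abs[THEN order_trans], rule sum_mono)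
    fix i
    have "\<bar>lucas (Suc i) * psi + lucas i\<bar> = \<bar>psi ^ i\<bar> * \<bar>psi + 2\<bar>"
      using golden_recurrence[of lucas i] by (simp add: abs_mult)
    also have "\<dots> \<le> \<bar>psi ^ i\<bar> * 2" using psi by (intro mult_left_mono) auto
    finally show "\<bar>lucas (Suc i) * psi + lucas i\<bar> \<le> 2 * \<bar>psi ^ i\<bar>" by simp
  qed
  then have 2: "\<bar>\<Sum>i\<in>I. lucas (Suc i) * psi + lucas i\<bar> \<le> 6"
    using sum_psi_power_le[OF I] unfolding sum_distrib_left[symmetric] by linarith
  have "p * psi + q = (weighted_sum (\<lambda>i. fib (Suc i)) u * psi + weighted_sum fib u) -
      (\<Sum>i\<in>I. lucas (Suc i) * psi + lucas i)"
    unfolding p q sum.distrib sum_distrib_right[symmetric] of_int_diff of_int_sum of_int_of_nat_eq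
      left_diff_distrib by linarith
  then show ?thesis using 1 2 by linarith
qed

lemma discrepancy_bound:
  assumes "(p, q) \<in> discrepancies u r"
    and "no_11 v" "J \<subseteq> {..<length v + 2}"
    and eq: "p * int (fib (length v + 2)) + q * int (fib (Suc (length v))) + int (fib_value v) =
      2 + (\<Sum>j\<in>J. int (lucas j))"
  shows "(p, q) \<in> {-26..26} \<times> {-26..26}"
proof -
  let ?m = "length v"
  \<comment> \<open>By \<open>fib_golden\<close>, F_(m+2) = y + psi F_(m+1), so the left side of
    \<open>eq\<close> without the suffix value is p y + s F_(m+1) with s bounded.\<close>
  define y where "y = phi ^ Suc ?m"
  have y: "y \<ge> 1" unfolding y_def using phi_gt_1 by (intro one_le_power) auto
  define s where "s = p * psi + q"
  have s: "\<bar>s\<bar> \<le> 9" unfolding s_def using assms(1) by (rule discrepancy_conjugate_bound)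
  have "fib_value v \<le> fib (?m + 2)" using fib_value_less[OF assms(2)] by simp
  also have "real (fib (?m + 2)) \<le> phi * y" using fib_le_phi_power[of "?m + 2"] by (simp add: y_def)
  also have "\<dots> \<le> 2 * y" using phi_less_2 y by simp
  finally have v: "fib_value v \<le> 2 * y" by simp
  have "(\<Sum>j\<in>J. lucas j) \<le> (\<Sum>j<?m + 2. lucas j)"
    using assms(3) by (intro sum_mono2) auto
  also have "\<dots> \<le> lucas (?m + 3)" using sum_lucas[of "?m + 2"] by (simp add: numeral_eq_Suc)
  finally have "real (\<Sum>j\<in>J. lucas j) \<le> lucas (?m + 3)" by (simp only: of_nat_le_iff)
  also have "\<dots> \<le> 2 * phi\<^sup>2 * y"
    using lucas_le_phi_power[of "?m + 3"] by (simp add: y_def numeral_eq_Suc algebra_simps)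
  also have "\<dots> \<le> 6 * y" unfolding phi_square using phi_less_2 y by simp
  finally have J: "real (\<Sum>j\<in>J. lucas j) \<le> 6 * y" .
  have "p * real (fib (?m + 2)) + q * real (fib (Suc ?m)) + fib_value v = 2 + real (\<Sum>j\<in>J. lucas j)"
    using arg_cong[OF eq, of real_of_int] by simp
  moreover have "p * real (fib (?m + 2)) + q * real (fib (Suc ?m)) = p * y + s * fib (Suc ?m)"
    unfolding s_def y_def using fib_golden[of "Suc ?m", symmetric] by (simp add: algebra_simps)
  ultimately have py: "p * y = 2 + real (\<Sum>j\<in>J. lucas j) - fib_value v - s * fib (Suc ?m)" by linarith
  have "\<bar>s * fib (Suc ?m)\<bar> \<le> 9 * y"
    unfolding abs_mult y_def using s fib_le_phi_power[of "Suc ?m"] by (intro mult_mono) auto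
  \<comment> \<open>The constant is 2 + 6 + 9, with 2 \<le> 2 y; the suffix value is nonnegative and
    only matters for the lower bound.\<close>
  then have "\<bar>p * y\<bar> \<le> 17 * y" unfolding py using v J y by linarith
  then have p: "\<bar>real_of_int p\<bar> \<le> 17" using y by (simp add: abs_mult)
  have "\<bar>p * psi\<bar> \<le> 17 * 1"
    unfolding abs_mult using p phi_gt_1 by (intro mult_mono) auto
  then have "\<bar>real_of_int q\<bar> \<le> 26" using s unfolding s_def by linarith
  then show ?thesis using p by auto
qed

section \<open>Residuals of the language\<close>

lemma one_odd_exponent_iff_even_lucas_sum:
  "n \<in> one_odd_exponent \<longleftrightarrow>
     (\<exists>J. finite J \<and> (\<forall>j\<in>J. even j \<and> 4 \<le> j) \<and> int n = 2 + (\<Sum>j\<in>J. int (lucas j)))"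
  unfolding one_odd_exponent_iff_lucas_sum
proof safe
  fix S assume S: "finite S" "S \<subseteq> {2..}" "int n - 2 = (\<Sum>i\<in>S. int (lucas (2 * i)))"
  have "(\<Sum>j\<in>(\<lambda>i. 2 * i) ` S. int (lucas j)) = (\<Sum>i\<in>S. int (lucas (2 * i)))"
    by (subst sum.reindex) (auto simp: inj_on_def)
  then show "\<exists>J. finite J \<and> (\<forall>j\<in>J. even j \<and> 4 \<le> j) \<and> int n = 2 + (\<Sum>j\<in>J. int (lucas j))"
    using S by (intro exI[of _ "(\<lambda>i. 2 * i) ` S"]) auto
next
  fix J :: "nat set"
  assume J: "finite J" "\<forall>j\<in>J. even j \<and> 4 \<le> j" "int n = 2 + (\<Sum>j\<in>J. int (lucas j))"
  have "2 * (j div 2) = j" if "j \<in> J" for j using J(2) that by simp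
  then have "inj_on (\<lambda>j. j div 2) J" by (rule inj_on_inverseI)
  then have "(\<Sum>i\<in>(\<lambda>j. j div 2) ` J. int (lucas (2 * i))) = (\<Sum>j\<in>J. int (lucas j))"
    using J(2) by (subst sum.reindex) (auto intro!: sum.cong)
  then show "\<exists>S. finite S \<and> S \<subseteq> {2..} \<and> int n - 2 = (\<Sum>i\<in>S. int (lucas (2 * i)))"
    using J by (intro exI[of _ "(\<lambda>j. j div 2) ` J"]) auto
qed

text \<open>Cut the set of Lucas indices at m + 2, where m is the length of \<open>v\<close>. The
  upper part, shifted down, yields the pair (p, q); the lower part is \<open>J\<close>, and
  solvability forces the pair into the box.\<close>

lemma fib_value_append_in_one_odd_exponent_iff:
  assumes "no_11 v" "v \<noteq> []"
  shows "fib_value (u @ v) \<in> one_odd_exponent \<longleftrightarrow>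
    (\<exists>(p, q) \<in> discrepancies u (length v mod 2) \<inter> ({-26..26} \<times> {-26..26}).
      \<exists>J \<subseteq> {..<length v + 2}. (\<forall>j\<in>J. even j \<and> 4 \<le> j) \<and>
        p * int (fib (length v + 2)) + q * int (fib (Suc (length v))) + int (fib_value v) =
        2 + (\<Sum>j\<in>J. int (lucas j)))"
    (is "?L \<longleftrightarrow> ?R")
proof -
  define m where "m = length v"
  \<comment> \<open>Guarantees that every even index m + 2 + i is at least 4.\<close>
  have m: "m \<ge> 1" using assms(2) by (cases v) (auto simp: m_def)
  let ?P = "\<lambda>I. int (weighted_sum (\<lambda>i. fib (Suc i)) u) - (\<Sum>i\<in>I. int (lucas (Suc i)))"
  let ?Q = "\<lambda>I. int (weighted_sum fib u) - (\<Sum>i\<in>I. int (lucas i))"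
  have split: "int (fib_value (u @ v)) = 2 + (\<Sum>j\<in>J \<union> (+) (m + 2) ` I. int (lucas j)) \<longleftrightarrow>
      ?P I * int (fib (m + 2)) + ?Q I * int (fib (Suc m)) + int (fib_value v) =
        2 + (\<Sum>j\<in>J. int (lucas j))"
    if "finite I" "finite J" "J \<subseteq> {..<m + 2}" for I J
  proof -
    have "(\<Sum>j\<in>J \<union> (+) (m + 2) ` I. int (lucas j)) =
        (\<Sum>j\<in>J. int (lucas j)) + (\<Sum>j\<in>(+) (m + 2) ` I. int (lucas j))"
      using that by (intro sum.union_disjoint) auto
    also have "(\<Sum>j\<in>(+) (m + 2) ` I. int (lucas j)) = (\<Sum>i\<in>I. int (lucas (m + 2 + i)))"
      by (subst sum.reindex) (auto simp: inj_on_def)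
    also have "\<dots> = (\<Sum>i\<in>I. int (lucas (Suc i))) * int (fib (m + 2)) +
        (\<Sum>i\<in>I. int (lucas i)) * int (fib (Suc m))"
      unfolding lucas_add by (simp only: of_nat_add of_nat_mult sum.distrib sum_distrib_right)
    finally show ?thesis
      unfolding fib_value_append m_def[symmetric] of_nat_add of_nat_mult left_diff_distrib
      by linarith
  qed
  show ?thesis
  proof
    assume ?L
    then obtain J where J: "finite J" "\<forall>j\<in>J. even j \<and> 4 \<le> j"
      "int (fib_value (u @ v)) = 2 + (\<Sum>j\<in>J. int (lucas j))"
      unfolding one_odd_exponent_iff_even_lucas_sum by blast
    define I where "I = {i. m + 2 + i \<in> J}"
    have sub: "(+) (m + 2) ` I \<subseteq> J" by (auto simp: I_def)
    then have "finite ((+) (m + 2) ` I)" using J(1) by (rule finite_subset)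
    then have finI: "finite I" by (rule finite_imageD) (simp add: inj_on_def)
    let ?J = "J \<inter> {..<m + 2}"
    have "j \<in> (+) (m + 2) ` I" if "j \<in> J" and ge: "\<not> j < m + 2" for j
    proof -
      obtain i where "j = m + 2 + i" using ge le_Suc_ex not_less by blast
      then show ?thesis using \<open>j \<in> J\<close> unfolding I_def by blast
    qed
    then have J_eq: "?J \<union> (+) (m + 2) ` I = J" using sub by blast
    have "finite ?J" "?J \<subseteq> {..<m + 2}" using J(1) by auto
    then have eq: "?P I * int (fib (m + 2)) + ?Q I * int (fib (Suc m)) + int (fib_value v) =
        2 + (\<Sum>j\<in>?J. int (lucas j))"
      using split[of I ?J, unfolded J_eq] J(3) finI by blast
    have "i mod 2 = m mod 2" if "i \<in> I" for i
    proof -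
      have "even (m + 2 + i)" using that J(2) by (auto simp: I_def)
      then show ?thesis by presburger
    qed
    then have mem: "(?P I, ?Q I) \<in> discrepancies u (m mod 2)"
      unfolding discrepancies_def using finI by blast
    then have "(?P I, ?Q I) \<in> {-26..26} \<times> {-26..26}"
      using assms(1) _ eq[unfolded m_def] by (rule discrepancy_bound) (simp add: m_def)
    moreover have "\<exists>J \<subseteq> {..<m + 2}. (\<forall>j\<in>J. even j \<and> 4 \<le> j) \<and>
        ?P I * int (fib (m + 2)) + ?Q I * int (fib (Suc m)) + int (fib_value v) =
        2 + (\<Sum>j\<in>J. int (lucas j))"
      using eq J(2) by (intro exI[of _ ?J]) (simp only: Int_lower2 Int_iff, blast)
    ultimately show ?R
      unfolding m_def[symmetric] using mem by (intro bexI[of _ "(?P I, ?Q I)"]) (simp_all only: prod.case Int_iff)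
  next
    assume ?R
    then obtain p q J where pq: "(p, q) \<in> discrepancies u (m mod 2)"
      and J: "J \<subseteq> {..<m + 2}" "\<forall>j\<in>J. even j \<and> 4 \<le> j"
      and eq: "p * int (fib (m + 2)) + q * int (fib (Suc m)) + int (fib_value v) =
        2 + (\<Sum>j\<in>J. int (lucas j))"
      unfolding m_def by blast
    obtain I where I: "finite I" "\<forall>i\<in>I. i mod 2 = m mod 2" and pq_eq: "p = ?P I" "q = ?Q I"
      using pq unfolding discrepancies_def by blast
    have finJ: "finite J" using J(1) by (rule finite_subset) simp
    have "even j \<and> 4 \<le> j" if j: "j \<in> (+) (m + 2) ` I" for j
    proof -
      obtain i where i: "i \<in> I" "j = m + 2 + i" using j by blast
      then have "even j" using I(2) by (auto simp: mod2_eq_if split: if_splits)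
      then show ?thesis using i m by presburger
    qed
    then have "\<forall>j\<in>J \<union> (+) (m + 2) ` I. even j \<and> 4 \<le> j" using J(2) by blast
    moreover have "int (fib_value (u @ v)) = 2 + (\<Sum>j\<in>J \<union> (+) (m + 2) ` I. int (lucas j))"
      using split[OF I(1) finJ J(1)] eq unfolding pq_eq by (rule iffD2)
    moreover have "finite (J \<union> (+) (m + 2) ` I)" using I(1) finJ by simp
    ultimately show ?L unfolding one_odd_exponent_iff_even_lucas_sum by blast
  qed
qed

lemma regular_zeckendorf_one_odd_exponent:
  "regular_language (zeckendorf ` one_odd_exponent)"
proof -
  let ?B = "{-26..26} \<times> {-26..26} :: (int \<times> int) set"
  let ?A = "zeckendorf ` one_odd_exponent"
  \<comment> \<open>All that a suffix can detect of \<open>u\<close>: membership settles the empty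
    suffix, the first and last letters and \<open>no_11\<close> settle admissibility of the joined
    word, and the bounded discrepancies for both parities settle its value.\<close>
  define f where "f u = (u \<in> ?A, u = [], u \<noteq> [] \<and> hd u, u \<noteq> [] \<and> last u, no_11 u,
    discrepancies u 0 \<inter> ?B, discrepancies u 1 \<inter> ?B)" for u
  show ?thesis
  proof (rule regular_language_finite_classes)
    have "range f \<subseteq> UNIV \<times> UNIV \<times> UNIV \<times> UNIV \<times> UNIV \<times> Pow ?B \<times> Pow ?B"
      by (auto simp: f_def)
    then show "finite (range f)" by (rule finite_subset) (intro finite_cartesian_product finite_Pow_iff[THEN iffD2]; simp)
  next
    fix u u' v assume f: "f u = f u'"
    show "u @ v \<in> ?A \<longleftrightarrow> u' @ v \<in> ?A"
    proof (cases "v = [] \<or> \<not> no_11 v")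
      case True
      then show ?thesis
      proof
        assume "v = []"
        then show ?thesis using f by (simp add: f_def)
      next
        assume "\<not> no_11 v"
        then show ?thesis by (simp add: zeckendorf_image successively_append_iff)
      qed
    next
      case False
      then have v: "no_11 v" "v \<noteq> []" by auto
      have "discrepancies u r \<inter> ?B = discrepancies u' r \<inter> ?B" if "r = 0 \<or> r = 1" for r
        using f that by (auto simp: f_def)
      then have "discrepancies u (length v mod 2) \<inter> ?B = discrepancies u' (length v mod 2) \<inter> ?B"
        by (meson mod2_eq_if)
      then have "fib_value (u @ v) \<in> one_odd_exponent \<longleftrightarrow> fib_value (u' @ v) \<in> one_odd_exponent"
        unfolding fib_value_append_in_one_odd_exponent_iff[OF v] by (simp only:)
      moreover have "hd (u @ v) \<longleftrightarrow> hd (u' @ v)"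
        using f by (cases "u = []") (auto simp: f_def)
      moreover have "no_11 (u @ v) \<longleftrightarrow> no_11 (u' @ v)"
        using f by (auto simp: f_def successively_append_iff)
      ultimately show ?thesis using v(2) unfolding zeckendorf_image by simp
    qed
  qed
qed

theorem theorem8:
  shows "regular_language (zeckendorf ` one_odd_exponent) \<and>
    (\<forall>n::nat. n \<in> one_odd_exponent \<longleftrightarrow>
       (\<exists>S::nat set. finite S \<and> S \<subseteq> {2..} \<and> int n - 2 = (\<Sum>i\<in>S. int (lucas (2 * i))))) \<and>
    (\<forall>n \<in> one_odd_exponent. (THE i. i \<in> phi_exponents (real n) \<and> odd i) = 1)"
proof (intro conjI allI ballI)
  fix n assume "n \<in> one_odd_exponent"
  then have "{i \<in> phi_exponents (real n). odd i} = {1}"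
    using one_odd_exponent_iff_lucas_sum odd_phi_exponents_lucas_sum by blast
  then show "(THE i. i \<in> phi_exponents (real n) \<and> odd i) = 1"
    by (intro the_equality) auto
qed (rule regular_zeckendorf_one_odd_exponent one_odd_exponent_iff_lucas_sum)+

end
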